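(* Let $h_M,h_E$ be independent nonnegative random variables with bounded continuous densities $f(h_M)$ and $f(h_E)$ on $[0,\infty)$ and with $\mathbb E\{h_M\}<\infty$. For $\bar P>0$ let $C_s^{(F)}(\bar P)$ be the full-CSI secrecy capacity and $R_s^{(CP)}(\bar P)$ the perfect secrecy rate of the on/off power control scheme with optimized threshold, both as given in the context. Then $$\lim_{\bar P\to\infty}R_s^{(CP)}(\bar P)=\lim_{\bar P\to\infty}C_s^{(F)}(\bar P)=\int_0^\infty\int_0^{h_M}\log\Big(\frac{h_M}{h_E}\Big)f(h_M)f(h_E)\,dh_E\,dh_M<\infty .$$ That is, the on/off power allocation policy, which uses only the main channel CSI, achieves the secrecy capacity under the full CSI assumption as $\bar P\to\infty$.
   Context: $h_M$ and $h_E$ are the fading power gains of the main channel (to the legitimate receiver) and of the eavesdropper channel; the two densities may differ, the argument indicating which is meant. $[x]^+=\max\{0,x\}$. Full-CSI secrecy capacity: $$C_s^{(F)}(\bar P)=\sup_{P}\int_0^\infty\int_{h_E}^\infty\Big[\log(1+h_MP(h_M,h_E))-\log(1+h_EP(h_M,h_E))\Big]f(h_M)f(h_E)\,dh_M\,dh_E,$$ the supremum being over measurable $P:[0,\infty)^2\to[0,\infty)$ with $\mathbb E\{P(h_M,h_E)\}\le\bar P$. On/off power control: for a threshold $\tau\ge0$ with $\Pr(h_M>\tau)>0$, the transmitter (knowing only $h_M$) transmits only when $h_M>\tau$, with constant power $P_\tau=\bar P/\Pr(h_M>\tau)$ and with rate $\log(1+h_MP_\tau)$. The perfect secrecy rate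 of this scheme is $$R_s(\tau,\bar P)=\int_0^\infty\int_\tau^\infty\Big[\log(1+h_MP_\tau)-\log(1+h_EP_\tau)\Big]^+f(h_M)f(h_E)\,dh_M\,dh_E,$$ and $R_s^{(CP)}(\bar P)=\sup_{\tau}R_s(\tau,\bar P)$. *)

theory Defs
  imports "HOL-Probability.Probability"
begin

text \<open>
  \<open>hM\<close>, \<open>hE\<close> are the fading power gains as random variables on \<open>M\<close>; \<open>fM\<close>, \<open>fE\<close> are their densities,
  of which only the values on \<open>[0, \<infinity>)\<close> matter. In the integrals \<open>x\<close> stands for the value of \<open>hM\<close> and
  \<open>y\<close> for that of \<open>hE\<close>. All rates are in nats (natural logarithm). They are \<open>ennreal\<close>-valued, so that
  suprema and integrals need no a priori finiteness; no integrand is negative on its domain of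
  integration, so the coercion \<open>ennreal\<close> truncates nothing.
\<close>

definition power_policies ::
  "'a measure \<Rightarrow> ('a \<Rightarrow> real) \<Rightarrow> ('a \<Rightarrow> real) \<Rightarrow> real \<Rightarrow> (real \<times> real \<Rightarrow> real) set" where
  "power_policies M hM hE Pbar =
    {P \<in> restrict_space borel ({0..} \<times> {0..}) \<rightarrow>\<^sub>M restrict_space borel {0..}.
       (\<integral>\<^sup>+ \<omega>. ennreal (P (hM \<omega>, hE \<omega>)) \<partial>M) \<le> ennreal Pbar}"

definition full_CSI_capacity ::
  "'a measure \<Rightarrow> ('a \<Rightarrow> real) \<Rightarrow> ('a \<Rightarrow> real) \<Rightarrow> (real \<Rightarrow> real) \<Rightarrow> (real \<Rightarrow> real) \<Rightarrow> real \<Rightarrow> ennreal" where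
  "full_CSI_capacity M hM hE fM fE Pbar =
    (SUP P \<in> power_policies M hM hE Pbar.
       \<integral>\<^sup>+ y \<in> {0..}. (\<integral>\<^sup>+ x \<in> {y..}.
         ennreal ((ln (1 + x * P (x, y)) - ln (1 + y * P (x, y))) * fM x * fE y) \<partial>lborel) \<partial>lborel)"

definition on_off_power :: "'a measure \<Rightarrow> ('a \<Rightarrow> real) \<Rightarrow> real \<Rightarrow> real \<Rightarrow> real" where
  "on_off_power M hM \<tau> Pbar = Pbar / measure M {\<omega> \<in> space M. hM \<omega> > \<tau>}"

definition on_off_rate ::
  "'a measure \<Rightarrow> ('a \<Rightarrow> real) \<Rightarrow> (real \<Rightarrow> real) \<Rightarrow> (real \<Rightarrow> real) \<Rightarrow> real \<Rightarrow> real \<Rightarrow> ennreal" where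
  "on_off_rate M hM fM fE \<tau> Pbar =
    (let P = on_off_power M hM \<tau> Pbar in
       \<integral>\<^sup>+ y \<in> {0..}. (\<integral>\<^sup>+ x \<in> {\<tau>..}.
         ennreal (max 0 (ln (1 + x * P) - ln (1 + y * P)) * fM x * fE y) \<partial>lborel) \<partial>lborel)"

definition on_off_secrecy_rate ::
  "'a measure \<Rightarrow> ('a \<Rightarrow> real) \<Rightarrow> (real \<Rightarrow> real) \<Rightarrow> (real \<Rightarrow> real) \<Rightarrow> real \<Rightarrow> ennreal" where
  "on_off_secrecy_rate M hM fM fE Pbar =
    (SUP \<tau> \<in> {\<tau>. 0 \<le> \<tau> \<and> measure M {\<omega> \<in> space M. hM \<omega> > \<tau>} > 0}. on_off_rate M hM fM fE \<tau> Pbar)"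

definition high_SNR_secrecy_rate :: "(real \<Rightarrow> real) \<Rightarrow> (real \<Rightarrow> real) \<Rightarrow> ennreal" where
  "high_SNR_secrecy_rate fM fE =
    (\<integral>\<^sup>+ x \<in> {0..}. (\<integral>\<^sup>+ y \<in> {0<..x}. ennreal (ln (x / y) * fM x * fE y) \<partial>lborel) \<partial>lborel)"

end

theory Submission
  imports Defs "HOL-Real_Asymp.Real_Asymp"
begin

text \<open>
  For \<open>0 < y \<le> x\<close> and \<open>p \<ge> 0\<close> we have \<open>(1 + x p) / (1 + y p) \<le> x / y\<close>, so the high-SNR rate bounds both
  rates from above at every power. Conversely, the threshold \<open>\<tau> = 0\<close> and the constant policy both
  transmit with power \<open>Pbar\<close> almost everywhere, and their common rate tends to the high-SNR rate by
  dominated convergence. The dominating function is integrable because the integral of \<open>ln (x / y)\<close>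
  over \<open>0 < y \<le> x\<close> is \<open>x\<close>, the density of \<open>hE\<close> is bounded, and \<open>hM\<close> has finite mean.
\<close>

section \<open>Bounds, limit and integral of the logarithmic terms\<close>

lemma ln_one_plus_diff_le:
  fixes x y p :: real
  assumes "0 < y" "y \<le> x" "0 \<le> p"
  shows "ln (1 + x * p) - ln (1 + y * p) \<le> ln (x / y)"
proof -
  have pos: "0 < 1 + x * p" "0 < 1 + y * p" "0 < x"
    using assms by (auto intro!: add_pos_nonneg)
  have "(1 + x * p) / (1 + y * p) \<le> x / y"
    using assms pos by (simp add: field_simps)
  then have "ln ((1 + x * p) / (1 + y * p)) \<le> ln (x / y)"
    using pos assms by (subst ln_le_cancel_iff) auto
  then show ?thesis
    using pos by (simp add: ln_div)
qed

lemma ln_one_plus_diff_nonneg: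
  fixes x y p :: real
  assumes "0 \<le> y" "y \<le> x" "0 \<le> p"
  shows "0 \<le> ln (1 + x * p) - ln (1 + y * p)"
proof -
  have "0 < 1 + y * p" "1 + y * p \<le> 1 + x * p"
    using assms by (auto intro!: add_pos_nonneg mult_right_mono)
  then show ?thesis by simp
qed

lemma ln_one_plus_diff_tendsto:
  fixes x y :: real
  assumes "0 < y" "0 < x"
  shows "((\<lambda>p. ln (1 + x * p) - ln (1 + y * p)) \<longlongrightarrow> ln (x / y)) at_top"
proof -
  have "((\<lambda>p. ln (1 + x * p) - ln (1 + y * p)) \<longlongrightarrow> ln x - ln y) at_top"
    using assms by real_asymp
  then show ?thesis
    using assms by (simp add: ln_div)
qed

text \<open>The integrand blows up at \<open>0\<close>, so the fundamental theorem is applied in its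
  improper form, with one-sided limits of an antiderivative at both ends. Nonnegativity of
  \<open>ln (x / y)\<close> on \<open>0 < y < x\<close> then gives integrability together with the
  value.\<close>

lemma nn_integral_ln_ratio:
  fixes x :: real
  assumes "0 < x"
  shows "(\<integral>\<^sup>+ y \<in> {0<..x}. ennreal (ln (x / y)) \<partial>lborel) = ennreal x"
proof -
  \<comment> \<open>Antiderivative of \<open>ln x - ln y\<close>. It tends to \<open>0\<close> at
    \<open>0\<close> because \<open>y * ln y\<close> does, and at \<open>y = x\<close> the
    logarithms cancel and leave \<open>x\<close>.\<close>
  define F where "F = (\<lambda>y. y * ln x - y * ln y + y)"
  have deriv: "DERIV F y :> ln (x / y)" if "0 < y" for y
    unfolding F_def using that assms by (auto intro!: derivative_eq_intros simp: ln_div)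
  have cont: "isCont (\<lambda>y. ln (x / y)) y" if "0 < y" for y
    using that assms by (auto intro!: continuous_intros)
  have lim0: "(F \<longlongrightarrow> 0) (at_right 0)"
    unfolding F_def using assms by real_asymp
  have "isCont F x"
    using deriv[OF assms] by (rule DERIV_isCont)
  then have "(F \<longlongrightarrow> F x) (at_left x)"
    unfolding isCont_def by (rule tendsto_within_subset) simp
  then have limx: "(F \<longlongrightarrow> x) (at_left x)"
    by (simp add: F_def)
  have limits: "((F \<circ> real_of_ereal) \<longlongrightarrow> 0) (at_right (ereal 0))"
    "((F \<circ> real_of_ereal) \<longlongrightarrow> x) (at_left (ereal x))"
    using lim0 limx by (simp_all only: ereal_tendsto_simps)
  have FTC: "set_integrable lborel (einterval (ereal 0) (ereal x)) (\<lambda>y. ln (x / y))"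
    "(LBINT y=ereal 0..ereal x. ln (x / y)) = x - 0"
    by (rule interval_integral_FTC_nonneg[OF _ _ _ _ limits]; use assms deriv cont in simp)+
  have "einterval (ereal 0) (ereal x) = {0<..<x}"
    by (auto simp: einterval_def)
  with FTC assms have int: "set_integrable lborel {0<..<x} (\<lambda>y. ln (x / y))"
    "(LBINT y:{0<..<x}. ln (x / y)) = x"
    by (auto simp: interval_lebesgue_integral_def)
  have "(\<integral>\<^sup>+ y \<in> {0<..x}. ennreal (ln (x / y)) \<partial>lborel)
      = (\<integral>\<^sup>+ y. ennreal (indicator {0<..<x} y *\<^sub>R ln (x / y)) \<partial>lborel)"
    using AE_lborel_singleton[of x]
    by (intro nn_integral_cong_AE) (auto elim!: eventually_mono split: split_indicator)
  also have "\<dots> = ennreal (LBINT y:{0<..<x}. ln (x / y))"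
    using int(1) unfolding set_integrable_def set_lebesgue_integral_def
    by (rule nn_integral_eq_integral) (auto split: split_indicator)
  finally show ?thesis
    by (simp add: int(2))
qed

section \<open>Integrands on the region \<open>0 < y \<le> x\<close> of the plane\<close>

text \<open>The region of integration is an indicator on the plane, so that the kernel is jointly
  measurable and can be integrated over the product measure. The densities enter cut off to
  \<open>{0..}\<close>, the form in which their measurability is given.\<close>

definition log_ratio_kernel :: "(real \<Rightarrow> real) \<Rightarrow> (real \<Rightarrow> real) \<Rightarrow> real \<Rightarrow> real \<Rightarrow> ennreal" where
  "log_ratio_kernel fM fE x y =
    ennreal (ln (x / y) * (indicator {0..} x * fM x) * (indicator {0..} y * fE y))
      * indicator {(x, y). 0 < y \<and> y \<le> x} (x, y)"

text \<open>The secrecy integrand at constant power \<open>p\<close>, encoded in the same way; it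
  serves as a lower bound for both rates.\<close>

definition rate_kernel ::
  "(real \<Rightarrow> real) \<Rightarrow> (real \<Rightarrow> real) \<Rightarrow> real \<Rightarrow> real \<Rightarrow> real \<Rightarrow> ennreal" where
  "rate_kernel fM fE p x y =
    ennreal ((ln (1 + x * p) - ln (1 + y * p)) * (indicator {0..} x * fM x) * (indicator {0..} y * fE y))
      * indicator {(x, y). 0 < y \<and> y \<le> x} (x, y)"

lemma sets_positive_below_diagonal [measurable]:
  "{(x, y). 0 < y \<and> y \<le> x} \<in> sets (borel \<Otimes>\<^sub>M borel :: (real \<times> real) measure)"
proof -
  have "{z \<in> space (borel \<Otimes>\<^sub>M borel). 0 < snd z \<and> snd z \<le> fst z}
      \<in> sets (borel \<Otimes>\<^sub>M borel :: (real \<times> real) measure)"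
    by measurable
  then show ?thesis
    by (simp add: space_pair_measure case_prod_beta')
qed

context
  fixes fM fE :: "real \<Rightarrow> real"
  assumes meas [measurable]: "(\<lambda>x. indicator {0..} x * fM x) \<in> borel_measurable borel"
    "(\<lambda>y. indicator {0..} y * fE y) \<in> borel_measurable borel"
    and nonneg: "\<And>x. 0 \<le> x \<Longrightarrow> 0 \<le> fM x" "\<And>y. 0 \<le> y \<Longrightarrow> 0 \<le> fE y"
begin

lemma measurable_log_ratio_kernel [measurable]:
  "case_prod (log_ratio_kernel fM fE) \<in> borel_measurable (borel \<Otimes>\<^sub>M borel)"
  unfolding log_ratio_kernel_def by measurable

lemma measurable_rate_kernel [measurable]:
  "case_prod (rate_kernel fM fE p) \<in> borel_measurable (borel \<Otimes>\<^sub>M borel)"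
  unfolding rate_kernel_def by measurable

lemma log_ratio_kernel_eq:
  "log_ratio_kernel fM fE x y = (if 0 < y \<and> y \<le> x then ennreal (ln (x / y) * fM x * fE y) else 0)"
  by (simp add: log_ratio_kernel_def)

lemma rate_kernel_eq:
  "rate_kernel fM fE p x y =
    (if 0 < y \<and> y \<le> x then ennreal ((ln (1 + x * p) - ln (1 + y * p)) * fM x * fE y) else 0)"
  by (simp add: rate_kernel_def)

lemma weighted_ennreal_mono:
  assumes "u \<le> v" "0 \<le> x" "0 \<le> y"
  shows "ennreal (u * fM x * fE y) \<le> ennreal (v * fM x * fE y)"
  by (intro ennreal_leI mult_right_mono nonneg assms)

text \<open>Tonelli. The high-SNR rate has \<open>x\<close> as its outer variable, the two rates
  have \<open>y\<close>; after the swap they can be compared integrand by integrand.\<close>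

lemma high_SNR_secrecy_rate_eq:
  "high_SNR_secrecy_rate fM fE = (\<integral>\<^sup>+ y. (\<integral>\<^sup>+ x. log_ratio_kernel fM fE x y \<partial>lborel) \<partial>lborel)"
proof -
  have "high_SNR_secrecy_rate fM fE = (\<integral>\<^sup>+ x. (\<integral>\<^sup>+ y. log_ratio_kernel fM fE x y \<partial>lborel) \<partial>lborel)"
    unfolding high_SNR_secrecy_rate_def log_ratio_kernel_def
    by (auto intro!: nn_integral_cong simp flip: nn_integral_multc split: split_indicator)
  also have "\<dots> = (\<integral>\<^sup>+ y. (\<integral>\<^sup>+ x. log_ratio_kernel fM fE x y \<partial>lborel) \<partial>lborel)"
    by (rule lborel_pair.Fubini'[symmetric]) simp
  finally show ?thesis .
qed

lemma high_SNR_secrecy_rate_finite: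
  assumes fE: "bounded (fE ` {0..})"
    and mean: "(\<integral>\<^sup>+ x. ennreal (indicator {0..} x * fM x) * ennreal x \<partial>lborel) < \<infinity>"
  shows "high_SNR_secrecy_rate fM fE < \<infinity>"
proof -
  obtain B where B: "\<And>y. 0 \<le> y \<Longrightarrow> fE y \<le> B"
    using bounded_imp_bdd_above[OF fE] by (auto simp: bdd_above_def)
  have "0 \<le> B"
    using B[of 0] nonneg(2)[of 0] by simp
  \<comment> \<open>Replacing \<open>fE\<close> by its bound \<open>B\<close> leaves the integral of
    \<open>ln (x / y)\<close>, which is \<open>x\<close>; what remains is \<open>B\<close> times the
    integrand of the mean of \<open>hM\<close>. For \<open>x \<le> 0\<close> the inner domain is
    empty.\<close>
  have inner: "(\<integral>\<^sup>+ y \<in> {0<..x}. ennreal (ln (x / y) * fM x * fE y) \<partial>lborel) * indicator {0..} x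
      \<le> ennreal B * (ennreal (indicator {0..} x * fM x) * ennreal x)" for x
  proof (cases "0 < x")
    case True
    have "(\<integral>\<^sup>+ y \<in> {0<..x}. ennreal (ln (x / y) * fM x * fE y) \<partial>lborel)
        \<le> (\<integral>\<^sup>+ y. ennreal (B * fM x) * (ennreal (ln (x / y)) * indicator {0<..x} y) \<partial>lborel)"
    proof (intro nn_integral_mono)
      fix y
      have "ln (x / y) * fM x * fE y \<le> ln (x / y) * fM x * B" if "0 < y" "y \<le> x"
        using that B[of y] nonneg(1)[of x] True by (intro mult_left_mono) auto
      then show "ennreal (ln (x / y) * fM x * fE y) * indicator {0<..x} y
          \<le> ennreal (B * fM x) * (ennreal (ln (x / y)) * indicator {0<..x} y)"
        using True \<open>0 \<le> B\<close> nonneg(1)[of x]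
        by (auto split: split_indicator simp: mult_ac simp flip: ennreal_mult intro!: ennreal_leI)
    qed
    also have "\<dots> = ennreal (B * fM x) * ennreal x"
      using True by (subst nn_integral_cmult) (auto simp: nn_integral_ln_ratio)
    finally show ?thesis
      using True \<open>0 \<le> B\<close> nonneg(1)[of x] by (simp add: ennreal_mult mult_ac)
  next
    case False
    then show ?thesis
      by (auto split: split_indicator)
  qed
  have "high_SNR_secrecy_rate fM fE
      \<le> (\<integral>\<^sup>+ x. ennreal B * (ennreal (indicator {0..} x * fM x) * ennreal x) \<partial>lborel)"
    unfolding high_SNR_secrecy_rate_def by (intro nn_integral_mono inner)
  also have "\<dots> = ennreal B * (\<integral>\<^sup>+ x. ennreal (indicator {0..} x * fM x) * ennreal x \<partial>lborel)"
    by (rule nn_integral_cmult) simp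
  also have "\<dots> < \<infinity>"
    using mean by (simp add: ennreal_mult_less_top)
  finally show ?thesis .
qed

section \<open>The limit at constant power\<close>

lemma rate_integral_tendsto:
  assumes "high_SNR_secrecy_rate fM fE < \<infinity>"
  shows "((\<lambda>p. \<integral>\<^sup>+ y. (\<integral>\<^sup>+ x. rate_kernel fM fE p x y \<partial>lborel) \<partial>lborel)
    \<longlongrightarrow> high_SNR_secrecy_rate fM fE) at_top"
\<comment> \<open>Dominated convergence concerns sequences, so the limit is tested along an
  arbitrary sequence of powers tending to infinity.\<close>
proof (rule tendsto_at_topI_sequentially)
  fix X :: "nat \<Rightarrow> real"
  assume X: "filterlim X at_top sequentially"
  \<comment> \<open>Finitely many \<open>X n\<close> may be negative, where the domination by
    \<open>?K\<close> could fail. Clipping at \<open>0\<close> makes it hold for every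
    \<open>n\<close> and changes nothing eventually.\<close>
  let ?R = "\<lambda>n. case_prod (rate_kernel fM fE (max 0 (X n)))"
  let ?K = "case_prod (log_ratio_kernel fM fE)"
  have prod: "(\<integral>\<^sup>+ y. (\<integral>\<^sup>+ x. f x y \<partial>lborel) \<partial>lborel) = (\<integral>\<^sup>+ z. case_prod f z \<partial>(lborel \<Otimes>\<^sub>M lborel))"
    if "case_prod f \<in> borel_measurable (borel \<Otimes>\<^sub>M borel)" for f :: "real \<Rightarrow> real \<Rightarrow> ennreal"
    using that by (subst lborel_pair.nn_integral_snd[symmetric]) auto
  have "(\<lambda>n. \<integral>\<^sup>+ z. ?R n z \<partial>(lborel \<Otimes>\<^sub>M lborel)) \<longlonglongrightarrow> (\<integral>\<^sup>+ z. ?K z \<partial>(lborel \<Otimes>\<^sub>M lborel))"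
  proof (rule nn_integral_dominated_convergence[where w = ?K])
    show "AE z in lborel \<Otimes>\<^sub>M lborel. ?R n z \<le> ?K z" for n
      by (intro AE_I2) (auto simp: rate_kernel_eq log_ratio_kernel_eq
          intro!: weighted_ennreal_mono ln_one_plus_diff_le)
    show "(\<integral>\<^sup>+ z. ?K z \<partial>(lborel \<Otimes>\<^sub>M lborel)) < \<infinity>"
      using assms by (simp add: high_SNR_secrecy_rate_eq prod)
    show "AE z in lborel \<Otimes>\<^sub>M lborel. (\<lambda>n. ?R n z) \<longlonglongrightarrow> ?K z"
    proof (intro AE_I2)
      fix z :: "real \<times> real"
      obtain x y where z: "z = (x, y)"
        by fastforce
      have "filterlim (\<lambda>n. max 0 (X n)) at_top sequentially"
        by (rule filterlim_at_top_mono[OF X]) simp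
      then have "(\<lambda>n. ln (1 + x * max 0 (X n)) - ln (1 + y * max 0 (X n))) \<longlonglongrightarrow> ln (x / y)"
        if "0 < y" "y \<le> x"
        using that by (intro filterlim_compose[OF ln_one_plus_diff_tendsto]) auto
      then show "(\<lambda>n. ?R n z) \<longlonglongrightarrow> ?K z"
        by (cases "0 < y \<and> y \<le> x")
          (auto simp: z rate_kernel_eq log_ratio_kernel_eq intro!: tendsto_intros)
    qed
  qed auto
  then have "(\<lambda>n. \<integral>\<^sup>+ y. (\<integral>\<^sup>+ x. rate_kernel fM fE (max 0 (X n)) x y \<partial>lborel) \<partial>lborel)
      \<longlonglongrightarrow> high_SNR_secrecy_rate fM fE"
    by (simp add: high_SNR_secrecy_rate_eq prod)
  moreover have "\<forall>\<^sub>F n in sequentially. 0 \<le> X n"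
    using X by (auto simp: filterlim_at_top)
  then have "\<forall>\<^sub>F n in sequentially.
      (\<integral>\<^sup>+ y. (\<integral>\<^sup>+ x. rate_kernel fM fE (max 0 (X n)) x y \<partial>lborel) \<partial>lborel)
        = (\<integral>\<^sup>+ y. (\<integral>\<^sup>+ x. rate_kernel fM fE (X n) x y \<partial>lborel) \<partial>lborel)"
    by eventually_elim simp
  ultimately show "(\<lambda>n. \<integral>\<^sup>+ y. (\<integral>\<^sup>+ x. rate_kernel fM fE (X n) x y \<partial>lborel) \<partial>lborel)
      \<longlonglongrightarrow> high_SNR_secrecy_rate fM fE"
    by (rule Lim_transform_eventually)
qed

text \<open>Only \<open>0 < y\<close> can be asked for, because at \<open>y = 0\<close> the value \<open>ln (x / y) = 0\<close> (by \<open>x / 0 = 0\<close>) fails to dominate.\<close>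

lemma secrecy_integral_le_high_SNR:
  assumes "\<And>x y. 0 < y \<Longrightarrow> g x y \<le> log_ratio_kernel fM fE x y"
  shows "(\<integral>\<^sup>+ y \<in> {0..}. (\<integral>\<^sup>+ x. g x y \<partial>lborel) \<partial>lborel) \<le> high_SNR_secrecy_rate fM fE"
  unfolding high_SNR_secrecy_rate_eq
  using AE_lborel_singleton[of 0]
  by (intro nn_integral_mono_AE)
    (auto elim!: eventually_mono intro!: nn_integral_mono assms split: split_indicator)

text \<open>The kernel vanishes for \<open>y \<le> 0\<close>, so a comparison at positive
  \<open>y\<close> is enough.\<close>

lemma rate_integral_le:
  assumes "\<And>x y. 0 < y \<Longrightarrow> rate_kernel fM fE p x y \<le> g x y"
  shows "(\<integral>\<^sup>+ y. (\<integral>\<^sup>+ x. rate_kernel fM fE p x y \<partial>lborel) \<partial>lborel)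
    \<le> (\<integral>\<^sup>+ y \<in> {0..}. (\<integral>\<^sup>+ x. g x y \<partial>lborel) \<partial>lborel)"
proof (intro nn_integral_mono)
  fix y
  have "rate_kernel fM fE p x y = 0" if "\<not> 0 < y" for x
    using that by (simp add: rate_kernel_def)
  then show "(\<integral>\<^sup>+ x. rate_kernel fM fE p x y \<partial>lborel) \<le> (\<integral>\<^sup>+ x. g x y \<partial>lborel) * indicator {0..} y"
    by (cases "0 < y") (auto intro!: nn_integral_mono assms)
qed

section \<open>The high-SNR rate as an upper bound\<close>

lemma full_CSI_capacity_le:
  "full_CSI_capacity M hM hE fM fE Pbar \<le> high_SNR_secrecy_rate fM fE"
  unfolding full_CSI_capacity_def
proof (intro SUP_least secrecy_integral_le_high_SNR)
  fix P x y
  assume P: "P \<in> power_policies M hM hE Pbar" and "0 < (y::real)"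
  \<comment> \<open>Policies take nonnegative values only on the closed quadrant;
    \<open>0 < y \<le> x\<close> puts the point there.\<close>
  have "0 \<le> P (x, y)" if "y \<le> x"
  proof -
    have "(x, y) \<in> space (restrict_space borel ({0..} \<times> {0..}))"
      using that \<open>0 < y\<close> by (simp add: space_restrict_space)
    moreover have "P \<in> restrict_space borel ({0..} \<times> {0..}) \<rightarrow>\<^sub>M restrict_space borel {0..}"
      using P by (simp add: power_policies_def)
    ultimately have "P (x, y) \<in> space (restrict_space borel {0..})"
      by (metis measurable_space)
    then show ?thesis
      by (simp add: space_restrict_space)
  qed
  then show "ennreal ((ln (1 + x * P (x, y)) - ln (1 + y * P (x, y))) * fM x * fE y) * indicator {y..} x
      \<le> log_ratio_kernel fM fE x y"
    using \<open>0 < y\<close>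
    by (cases "y \<le> x")
      (auto simp: log_ratio_kernel_eq intro!: weighted_ennreal_mono ln_one_plus_diff_le)
qed

text \<open>The positive part removes the region \<open>x < y\<close>, where the log-ratio kernel is
  \<open>0\<close>, and the threshold only shrinks the rest.\<close>

lemma on_off_secrecy_rate_le:
  assumes "0 \<le> Pbar"
  shows "on_off_secrecy_rate M hM fM fE Pbar \<le> high_SNR_secrecy_rate fM fE"
  unfolding on_off_secrecy_rate_def on_off_rate_def Let_def
proof (intro SUP_least secrecy_integral_le_high_SNR)
  fix \<tau> x y
  assume "\<tau> \<in> {\<tau>. 0 \<le> \<tau> \<and> measure M {\<omega> \<in> space M. hM \<omega> > \<tau>} > 0}" and y: "0 < (y::real)"
  then have \<tau>: "0 \<le> \<tau>" by simp
  define p where "p = on_off_power M hM \<tau> Pbar"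
  have p: "0 \<le> p"
    using assms by (simp add: p_def on_off_power_def)
  \<comment> \<open>The monotonicity lemma is used with \<open>x\<close> and \<open>y\<close>
    exchanged; \<open>0 \<le> x\<close> comes from \<open>0 \<le> \<tau> \<le> x\<close>.\<close>
  have "ln (1 + x * p) - ln (1 + y * p) \<le> 0" if "\<tau> \<le> x" "x < y"
    using ln_one_plus_diff_nonneg[of x y p] that \<tau> p by simp
  then have "max 0 (ln (1 + x * p) - ln (1 + y * p)) = 0" if "\<tau> \<le> x" "x < y"
    using that by (simp only: max_absorb1)
  moreover have "max 0 (ln (1 + x * p) - ln (1 + y * p)) \<le> ln (x / y)" if "y \<le> x"
    using ln_one_plus_diff_le[of y x p] that y p by simp
  ultimately have "ennreal (max 0 (ln (1 + x * p) - ln (1 + y * p)) * fM x * fE y) * indicator {\<tau>..} x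
      \<le> log_ratio_kernel fM fE x y"
    using y
    by (cases "y \<le> x"; cases "\<tau> \<le> x")
      (simp_all add: log_ratio_kernel_eq weighted_ennreal_mono del: max.bounded_iff)
  then show "ennreal (max 0 (ln (1 + x * on_off_power M hM \<tau> Pbar) - ln (1 + y * on_off_power M hM \<tau> Pbar))
      * fM x * fE y) * indicator {\<tau>..} x \<le> log_ratio_kernel fM fE x y"
    by (simp add: p_def)
qed

section \<open>The constant-power rate as a lower bound\<close>

lemma rate_integral_le_full_CSI_capacity:
  assumes "prob_space M" "0 \<le> Pbar"
  shows "(\<integral>\<^sup>+ y. (\<integral>\<^sup>+ x. rate_kernel fM fE Pbar x y \<partial>lborel) \<partial>lborel)
    \<le> full_CSI_capacity M hM hE fM fE Pbar"
  unfolding full_CSI_capacity_def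
proof (rule SUP_upper2)
  \<comment> \<open>The constant policy meets the power constraint with equality, as
    \<open>M\<close> has total mass \<open>1\<close>.\<close>
  show "(\<lambda>_. Pbar) \<in> power_policies M hM hE Pbar"
    using assms by (auto simp: power_policies_def space_restrict_space prob_space.emeasure_space_1)
  show "(\<integral>\<^sup>+ y. (\<integral>\<^sup>+ x. rate_kernel fM fE Pbar x y \<partial>lborel) \<partial>lborel)
    \<le> (\<integral>\<^sup>+ y \<in> {0..}. (\<integral>\<^sup>+ x \<in> {y..}.
         ennreal ((ln (1 + x * Pbar) - ln (1 + y * Pbar)) * fM x * fE y) \<partial>lborel) \<partial>lborel)"
    by (rule rate_integral_le) (simp add: rate_kernel_eq)
qed

text \<open>If \<open>hM\<close> is almost surely positive, threshold \<open>0\<close> never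
  switches the transmitter off, up to a null set, so its power is exactly
  \<open>Pbar\<close>.\<close>

lemma rate_integral_le_on_off_secrecy_rate:
  assumes "measure M {\<omega> \<in> space M. hM \<omega> > 0} = 1"
  shows "(\<integral>\<^sup>+ y. (\<integral>\<^sup>+ x. rate_kernel fM fE Pbar x y \<partial>lborel) \<partial>lborel)
    \<le> on_off_secrecy_rate M hM fM fE Pbar"
  unfolding on_off_secrecy_rate_def on_off_rate_def Let_def
proof (rule SUP_upper2)
  show "0 \<in> {\<tau>. 0 \<le> \<tau> \<and> measure M {\<omega> \<in> space M. hM \<omega> > \<tau>} > 0}"
    using assms by simp
  have "on_off_power M hM 0 Pbar = Pbar"
    using assms by (simp add: on_off_power_def)
  then show "(\<integral>\<^sup>+ y. (\<integral>\<^sup>+ x. rate_kernel fM fE Pbar x y \<partial>lborel) \<partial>lborel)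
    \<le> (\<integral>\<^sup>+ y \<in> {0..}. (\<integral>\<^sup>+ x \<in> {0..}.
         ennreal (max 0 (ln (1 + x * on_off_power M hM 0 Pbar) - ln (1 + y * on_off_power M hM 0 Pbar))
           * fM x * fE y) \<partial>lborel) \<partial>lborel)"
    by (intro rate_integral_le) (simp add: rate_kernel_eq weighted_ennreal_mono)
qed

end

theorem mainTheorem3:
  fixes M :: "'a measure" and hM hE :: "'a \<Rightarrow> real" and fM fE :: "real \<Rightarrow> real"
  assumes "prob_space M"
    and "prob_space.indep_var M borel hM borel hE"
    and "AE \<omega> in M. 0 \<le> hM \<omega>" and "AE \<omega> in M. 0 \<le> hE \<omega>"
    and "distributed M lborel hM (\<lambda>x. ennreal (indicator {0..} x * fM x))"
    and "distributed M lborel hE (\<lambda>y. ennreal (indicator {0..} y * fE y))"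
    and "\<And>x. 0 \<le> x \<Longrightarrow> 0 \<le> fM x" and "\<And>y. 0 \<le> y \<Longrightarrow> 0 \<le> fE y"
    and "continuous_on {0..} fM" and "continuous_on {0..} fE"
    and "bounded (fM ` {0..})" and "bounded (fE ` {0..})"
    and "integrable M hM"
  shows "(on_off_secrecy_rate M hM fM fE \<longlongrightarrow> high_SNR_secrecy_rate fM fE) at_top \<and>
    (full_CSI_capacity M hM hE fM fE \<longlongrightarrow> high_SNR_secrecy_rate fM fE) at_top \<and>
    high_SNR_secrecy_rate fM fE < \<infinity>"
proof -
  interpret prob_space M by fact
  have meas: "(\<lambda>x. indicator {0..} x * fM x) \<in> borel_measurable borel"
    "(\<lambda>y. indicator {0..} y * fE y) \<in> borel_measurable borel"
    using borel_measurable_continuous_on_indicator[OF _ assms(9)]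
      borel_measurable_continuous_on_indicator[OF _ assms(10)] by simp_all
  have [measurable]: "hM \<in> borel_measurable M"
    using assms(5) by (simp add: distributed_def)
  \<comment> \<open>The moment condition of the finiteness lemma is the mean of \<open>hM\<close>,
    written through its density.\<close>
  have "(\<integral>\<^sup>+ x. ennreal (indicator {0..} x * fM x) * ennreal x \<partial>lborel) = (\<integral>\<^sup>+ \<omega>. ennreal (hM \<omega>) \<partial>M)"
    by (rule distributed_nn_integral[OF assms(5)]) simp
  also have "\<dots> < \<infinity>"
    using assms(3,13) by (simp add: nn_integral_eq_integral)
  finally have finite: "high_SNR_secrecy_rate fM fE < \<infinity>"
    by (intro high_SNR_secrecy_rate_finite meas assms(7,8,12))
  note lim = rate_integral_tendsto[OF meas assms(7,8) finite]

  \<comment> \<open>A variable with a Lebesgue density has no atom at \<open>0\<close>; together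
    with nonnegativity this makes threshold \<open>0\<close> admissible with transmission
    probability \<open>1\<close>.\<close>
  have "AE \<omega> in M. hM \<omega> \<noteq> 0"
    using AE_lborel_singleton[of "0::real"]
    by (subst distributed_AE2[OF assms(5)]) (auto elim: eventually_mono)
  with assms(3) have "AE \<omega> in M. 0 < hM \<omega>"
    by eventually_elim simp
  then have pos: "measure M {\<omega> \<in> space M. hM \<omega> > 0} = 1"
    by (subst prob_Collect_eq_1) auto

  have "(on_off_secrecy_rate M hM fM fE \<longlongrightarrow> high_SNR_secrecy_rate fM fE) at_top"
  proof (rule tendsto_sandwich[OF _ _ lim tendsto_const])
    show "\<forall>\<^sub>F p in at_top. (\<integral>\<^sup>+ y. (\<integral>\<^sup>+ x. rate_kernel fM fE p x y \<partial>lborel) \<partial>lborel) \<le> on_off_secrecy_rate M hM fM fE p"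
      using eventually_ge_at_top[of 0]
      by eventually_elim (intro rate_integral_le_on_off_secrecy_rate[OF meas assms(7,8) pos])
    show "\<forall>\<^sub>F p in at_top. on_off_secrecy_rate M hM fM fE p \<le> high_SNR_secrecy_rate fM fE"
      using eventually_ge_at_top[of 0]
      by eventually_elim (intro on_off_secrecy_rate_le[OF meas assms(7,8)])
  qed
  moreover have "(full_CSI_capacity M hM hE fM fE \<longlongrightarrow> high_SNR_secrecy_rate fM fE) at_top"
  proof (rule tendsto_sandwich[OF _ _ lim tendsto_const])
    show "\<forall>\<^sub>F p in at_top. (\<integral>\<^sup>+ y. (\<integral>\<^sup>+ x. rate_kernel fM fE p x y \<partial>lborel) \<partial>lborel) \<le> full_CSI_capacity M hM hE fM fE p"
      using eventually_ge_at_top[of 0]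
      by eventually_elim (intro rate_integral_le_full_CSI_capacity[OF meas assms(7,8,1)])
    show "\<forall>\<^sub>F p in at_top. full_CSI_capacity M hM hE fM fE p \<le> high_SNR_secrecy_rate fM fE"
      using eventually_ge_at_top[of 0]
      by eventually_elim (intro full_CSI_capacity_le[OF meas assms(7,8)])
  qed
  ultimately show ?thesis
    using finite by blast
qed

end
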